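(* Let $\mathcal{I}$ be an ideal on $\omega$. Let $X$ be a metric space with the UC-property and let $\mathscr{F}=\{F_\lambda:\lambda\in X\}$ be a rough family of closed subsets of $X$ such that there exist $\eta\in X$ and a sequence $\bm{y}=(y_k:k\in\omega)\in X^\omega$ for which $\lim_k y_k=\eta$ and $y_k\notin F_\eta$ for all $k\in\omega$. Then $\mathcal{I}$ is a $P$-ideal if and only if $\mathsf{Lim}_{\bm{x}}(\mathcal{I}^\star,\mathscr{F})=\mathsf{Lim}_{\bm{x}}(\mathcal{I},\mathscr{F})$ for all $\bm{x}\in X^\omega$.
   Context: $\omega$ is the set of nonnegative integers. An ideal $\mathcal{I}$ on $\omega$ is a family $\mathcal{I}\subseteq\mathcal{P}(\omega)$ closed under subsets and finite unions, containing the family $\mathrm{Fin}$ of all finite subsets of $\omega$, and with $\omega\notin\mathcal{I}$. It is a $P$-ideal if for every increasing sequence $(S_j:j\in\omega)$ in $\mathcal{I}$ there exists $S\in\mathcal{I}$ such that $S_j\setminus S$ is finite for all $j\in\omega$. A rough family on a topological space $X$ is a collection $\mathscr{F}=\{F_\eta:\eta\in X\}$ of subsets of $X$ such that $\eta\in F_\eta$ for all $\eta\in X$. For a sequence $\bm{x}=(x_n:n\in\omega)$ in $X$: $\mathsf{Lim}_{\bm{x}}(\mathcal{I},\mathscr{F})$ is the set of all $\eta\in X$ such that $\{n\in\omega:x_n\notin U\}\in\mathcal{I}$ for all open sets $U\subseteq X$ with $F_\eta\subseteq U$. For an infinite $T\subseteq\omega$, the subsequence $(x_n:n\in T)$ is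 $\mathscr{F}$-convergent to $\eta$ if $\{n\in T:x_n\notin U\}$ is finite for all open $U\subseteq X$ with $F_\eta\subseteq U$. $\mathsf{Lim}_{\bm{x}}(\mathcal{I}^\star,\mathscr{F})$ is the set of all $\eta\in X$ for which there exists $S\in\mathcal{I}$ such that $(x_n:n\in\omega\setminus S)$ is $\mathscr{F}$-convergent to $\eta$. A metric space $(X,d)$ has the UC-property if for all nonempty disjoint closed sets $F,F'\subseteq X$ there exists $\varepsilon>0$ such that $d(x,x')>\varepsilon$ for all $x\in F$ and $x'\in F'$. *)

theory Defs
  imports "HOL-Analysis.Analysis"
begin

definition ideal_on_omega :: "nat set set \<Rightarrow> bool" where
  "ideal_on_omega I \<longleftrightarrow>
     (\<forall>A B. A \<in> I \<longrightarrow> B \<subseteq> A \<longrightarrow> B \<in> I) \<and>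
     (\<forall>A B. A \<in> I \<longrightarrow> B \<in> I \<longrightarrow> A \<union> B \<in> I) \<and>
     (\<forall>A. finite A \<longrightarrow> A \<in> I) \<and>
     UNIV \<notin> I"

definition P_ideal :: "nat set set \<Rightarrow> bool" where
  "P_ideal I \<longleftrightarrow> ideal_on_omega I \<and>
     (\<forall>S :: nat \<Rightarrow> nat set. incseq S \<longrightarrow> range S \<subseteq> I \<longrightarrow>
        (\<exists>T\<in>I. \<forall>j. finite (S j - T)))"

definition rough_family :: "('a::topological_space \<Rightarrow> 'a set) \<Rightarrow> bool" where
  "rough_family F \<longleftrightarrow> (\<forall>\<eta>. \<eta> \<in> F \<eta>)"

definition Lim_ideal ::
    "(nat \<Rightarrow> 'a::topological_space) \<Rightarrow> nat set set \<Rightarrow> ('a \<Rightarrow> 'a set) \<Rightarrow> 'a set" where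
  "Lim_ideal x I F = {\<eta>. \<forall>U. open U \<longrightarrow> F \<eta> \<subseteq> U \<longrightarrow> {n. x n \<notin> U} \<in> I}"

(* The subsequence of x indexed by T; of interest for infinite T. *)
definition rough_convergent_on ::
    "nat set \<Rightarrow> ('a::topological_space \<Rightarrow> 'a set) \<Rightarrow> (nat \<Rightarrow> 'a) \<Rightarrow> 'a \<Rightarrow> bool" where
  "rough_convergent_on T F x \<eta> \<longleftrightarrow>
     (\<forall>U. open U \<longrightarrow> F \<eta> \<subseteq> U \<longrightarrow> finite {n \<in> T. x n \<notin> U})"

(* If I is an ideal and S is in I, then - S is infinite, since I contains all
   finite sets and is proper; so no infinitude condition is needed here. *)
definition Lim_ideal_star ::
    "(nat \<Rightarrow> 'a::topological_space) \<Rightarrow> nat set set \<Rightarrow> ('a \<Rightarrow> 'a set) \<Rightarrow> 'a set" where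
  "Lim_ideal_star x I F = {\<eta>. \<exists>S\<in>I. rough_convergent_on (- S) F x \<eta>}"

definition UC_property :: "'a::metric_space itself \<Rightarrow> bool" where
  "UC_property (_ :: 'a itself) \<longleftrightarrow>
     (\<forall>A B :: 'a set. closed A \<longrightarrow> closed B \<longrightarrow> A \<noteq> {} \<longrightarrow> B \<noteq> {} \<longrightarrow> A \<inter> B = {} \<longrightarrow>
        (\<exists>\<epsilon>>0. \<forall>x\<in>A. \<forall>y\<in>B. dist x y > \<epsilon>))"

end

(* In a UC space the sets V j, the unions of the balls of radius 1/(j+1) centred in the closed
   set F \<eta>, form a countable base of its open neighbourhoods. So \<eta> is an I-limit of x iff the
   increasing sets {n. x n \<notin> V j} all lie in I, and a pseudo-union of them in I is a witness for
   I*-convergence. Conversely, given an increasing sequence S in I, the sequence x that sends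
   n to y k for the least k with n \<in> S k (and to \<eta> if there is none) I-converges to \<eta>;
   since - {y 0, ..., y j} is an open neighbourhood of F \<eta>, a witness of I*-convergence almost
   contains every S j. *)

theory Submission
  imports Defs
begin

text \<open>The indices where \<open>x\<close> leaves \<open>U\<close> lie in the witness
  \<open>S\<close> up to a finite set, and \<open>I\<close> absorbs finite sets.\<close>

lemma Lim_ideal_star_subset:
  assumes "ideal_on_omega I"
  shows "Lim_ideal_star x I F \<subseteq> Lim_ideal x I F"
proof
  fix \<eta> assume "\<eta> \<in> Lim_ideal_star x I F"
  then obtain S where S: "S \<in> I" "rough_convergent_on (- S) F x \<eta>"
    unfolding Lim_ideal_star_def by blast
  have "{n. x n \<notin> U} \<in> I" if "open U" "F \<eta> \<subseteq> U" for U
  proof -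
    have "finite {n \<in> - S. x n \<notin> U}"
      using S that unfolding rough_convergent_on_def by blast
    then have "S \<union> {n \<in> - S. x n \<notin> U} \<in> I"
      using S(1) assms unfolding ideal_on_omega_def by blast
    moreover have "{n. x n \<notin> U} \<subseteq> S \<union> {n \<in> - S. x n \<notin> U}"
      by blast
    ultimately show ?thesis
      using assms unfolding ideal_on_omega_def by blast
  qed
  then show "\<eta> \<in> Lim_ideal x I F"
    unfolding Lim_ideal_def by blast
qed

text \<open>The UC-property separates \<open>C\<close> from the closed set \<open>- U\<close> by
  some \<open>e\<close>, so no point within \<open>e\<close> of \<open>C\<close> lies outside
  \<open>U\<close>. It speaks of nonempty sets only, so \<open>U = UNIV\<close> is a separate case,
  where any radius works.\<close>

lemma UC_property_uniform_neighbourhood: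
  fixes C :: "'a::metric_space set"
  assumes "UC_property TYPE('a)" "closed C" "C \<noteq> {}" "open U" "C \<subseteq> U"
  obtains e where "e > 0" "(\<Union>z\<in>C. ball z e) \<subseteq> U"
proof (cases "- U = {}")
  case True
  then show ?thesis
    using that[of 1] by auto
next
  case False
  have "closed (- U)" "C \<inter> - U = {}"
    using assms by auto
  with assms False obtain e where "e > 0" "\<forall>z\<in>C. \<forall>w\<in>- U. dist z w > e"
    unfolding UC_property_def by meson
  then show ?thesis
    using that[of e] by (force simp: subset_iff)
qed

lemma Lim_ideal_subset_star:
  fixes F :: "'a::metric_space \<Rightarrow> 'a set"
  assumes "P_ideal I" "UC_property TYPE('a)" "rough_family F" "\<And>\<eta>. closed (F \<eta>)"
  shows "Lim_ideal x I F \<subseteq> Lim_ideal_star x I F"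
proof
  fix \<eta> assume \<eta>: "\<eta> \<in> Lim_ideal x I F"
  define V where "V j = (\<Union>z\<in>F \<eta>. ball z (inverse (real (Suc j))))" for j
  have "V (Suc j) \<subseteq> V j" for j
    unfolding V_def by (intro UN_mono subset_ball le_imp_inverse_le) auto
  then have "incseq (\<lambda>j. {n. x n \<notin> V j})"
    by (intro incseq_SucI) blast
  moreover have "open (V j)" "F \<eta> \<subseteq> V j" for j
    unfolding V_def by blast (force simp: subset_iff)
  then have "range (\<lambda>j. {n. x n \<notin> V j}) \<subseteq> I"
    using \<eta> unfolding Lim_ideal_def by blast
  ultimately obtain T where T: "T \<in> I" "\<And>j. finite ({n. x n \<notin> V j} - T)"
    using assms(1) unfolding P_ideal_def by meson
  have "finite {n \<in> - T. x n \<notin> U}" if "open U" "F \<eta> \<subseteq> U" for U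
  proof -
    have "F \<eta> \<noteq> {}"
      using assms(3) unfolding rough_family_def by auto
    then obtain e where e: "e > 0" "(\<Union>z\<in>F \<eta>. ball z e) \<subseteq> U"
      using UC_property_uniform_neighbourhood assms(2,4) \<open>open U\<close> \<open>F \<eta> \<subseteq> U\<close> by metis
    obtain j where "inverse (real (Suc j)) < e"
      using reals_Archimedean[OF e(1)] by blast
    \<comment> \<open>Hence \<open>V j\<close> lies inside \<open>U\<close>, and the indices that
      escape \<open>U\<close> are among those that escape \<open>V j\<close>, which \<open>T\<close>
      almost contains.\<close>
    then have "V j \<subseteq> (\<Union>z\<in>F \<eta>. ball z e)"
      unfolding V_def by (intro UN_mono subset_ball) auto
    with e(2) have "{n \<in> - T. x n \<notin> U} \<subseteq> {n. x n \<notin> V j} - T"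
      by blast
    then show ?thesis
      using T(2) finite_subset by blast
  qed
  then show "\<eta> \<in> Lim_ideal_star x I F"
    using T(1) unfolding Lim_ideal_star_def rough_convergent_on_def by blast
qed

text \<open>Only limits at the single point \<open>\<eta>\<close> enter, and the metric is replaced
  by the closedness of finite sets.\<close>

lemma P_ideal_if_Lim_ideal_subset_star:
  fixes F :: "'a::t1_space \<Rightarrow> 'a set"
  assumes I: "ideal_on_omega I" and "\<eta> \<in> F \<eta>"
    and y: "y \<longlonglongrightarrow> \<eta>" "\<And>k. y k \<notin> F \<eta>"
    and Lim: "\<And>x. \<eta> \<in> Lim_ideal x I F \<Longrightarrow> \<eta> \<in> Lim_ideal_star x I F"
  shows "P_ideal I"
  unfolding P_ideal_def
proof (intro conjI allI impI)
  fix S :: "nat \<Rightarrow> nat set"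
  assume S: "incseq S" "range S \<subseteq> I"
  \<comment> \<open>The default value \<open>\<eta>\<close> belongs to \<open>F \<eta>\<close>, so
    indices outside every \<open>S k\<close> never escape a neighbourhood of
    \<open>F \<eta>\<close>.\<close>
  define x where "x n = (if \<exists>k. n \<in> S k then y (LEAST k. n \<in> S k) else \<eta>)" for n
  have "{n. x n \<notin> U} \<in> I" if "open U" "F \<eta> \<subseteq> U" for U
  proof -
    have "\<eta> \<in> U"
      using \<open>\<eta> \<in> F \<eta>\<close> that by blast
    then obtain K where K: "\<And>k. k \<ge> K \<Longrightarrow> y k \<in> U"
      using topological_tendstoD[OF y(1) \<open>open U\<close>] unfolding eventually_sequentially by blast
    have "n \<in> S K" if n: "x n \<notin> U" for n
    proof -
      have ex: "\<exists>k. n \<in> S k" and "y (LEAST k. n \<in> S k) \<notin> U"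
        using n \<open>\<eta> \<in> U\<close> unfolding x_def by (auto split: if_splits)
      \<comment> \<open>From \<open>K\<close> on all \<open>y k\<close> are in \<open>U\<close>, so
        an escaping \<open>n\<close> enters the sequence \<open>S\<close> before stage
        \<open>K\<close> and stays, as \<open>S\<close> increases.\<close>
      then have "(LEAST k. n \<in> S k) \<le> K"
        using K nat_le_linear by blast
      then show ?thesis
        using LeastI_ex[OF ex] S(1) by (meson incseqD subsetD)
    qed
    then have "{n. x n \<notin> U} \<subseteq> S K"
      by blast
    moreover have "S K \<in> I"
      using S(2) by blast
    ultimately show ?thesis
      using I unfolding ideal_on_omega_def by blast
  qed
  then have "\<eta> \<in> Lim_ideal_star x I F"
    by (intro Lim) (simp add: Lim_ideal_def)
  then obtain T where T: "T \<in> I" "rough_convergent_on (- T) F x \<eta>"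
    unfolding Lim_ideal_star_def by blast
  have "finite (S j - T)" for j
  proof -
    have "open (- y ` {..j})" "F \<eta> \<subseteq> - y ` {..j}"
      using y(2) by (auto intro!: open_Compl finite_imp_closed)
    then have "finite {n \<in> - T. x n \<notin> - y ` {..j}}"
      using T(2) unfolding rough_convergent_on_def by blast
    moreover have "x n \<in> y ` {..j}" if "n \<in> S j" for n
      using that by (auto simp: x_def intro: Least_le)
    then have "S j - T \<subseteq> {n \<in> - T. x n \<notin> - y ` {..j}}"
      by blast
    ultimately show ?thesis
      using finite_subset by blast
  qed
  then show "\<exists>T\<in>I. \<forall>j. finite (S j - T)"
    using T(1) by blast
qed (fact I)

theorem proposition1p3:
  fixes I :: "nat set set" and F :: "'a::metric_space \<Rightarrow> 'a set"
  assumes "ideal_on_omega I"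
    and "UC_property TYPE('a)"
    and "rough_family F"
    and "\<And>\<eta>. closed (F \<eta>)"
    and "\<exists>(\<eta>::'a) (y :: nat \<Rightarrow> 'a). y \<longlonglongrightarrow> \<eta> \<and> (\<forall>k. y k \<notin> F \<eta>)"
  shows "P_ideal I \<longleftrightarrow> (\<forall>x :: nat \<Rightarrow> 'a. Lim_ideal_star x I F = Lim_ideal x I F)"
proof
  assume "P_ideal I"
  then show "\<forall>x. Lim_ideal_star x I F = Lim_ideal x I F"
    using Lim_ideal_star_subset[OF assms(1)] Lim_ideal_subset_star[OF _ assms(2-4)]
    by (intro allI subset_antisym)
next
  assume eq: "\<forall>x. Lim_ideal_star x I F = Lim_ideal x I F"
  obtain \<eta> y where "y \<longlonglongrightarrow> \<eta>" "\<And>k. y k \<notin> F \<eta>"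
    using assms(5) by blast
  moreover have "\<eta> \<in> F \<eta>"
    using assms(3) unfolding rough_family_def by blast
  ultimately show "P_ideal I"
    using P_ideal_if_Lim_ideal_subset_star[of I \<eta> F y] assms(1) eq by simp
qed

end
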